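(* Let $S$ be a left cancellative monoid with neutral element $e$, and let $R$ be a ring with an $S$-grading $\Gamma: R=\bigoplus_{g\in S}R_g$ of finite support; put $d=|\mathrm{Supp}(\Gamma)|$. If $R_e$ is nil, $\mathsf{f}$-commutative and finitely generated, then $R$ is a nilpotent ring. Moreover, if $R_e\neq\{0\}$ and $\{a_1,\dots,a_n\}$ generates $R_e$, then $s\leq\mathrm{nd}(R)\leq d((s-1)n+1)$, where $s=\min\{m\in\mathbb{N}: a_i^m=0 \text{ for } i=1,\dots,n\}$. If $R_e=\{0\}$, then $1\leq\mathrm{nd}(R)\leq d+1$.
   Context: Rings are associative, not necessarily with unity; $\mathbb{N}$ denotes the positive integers; "generates" and "finitely generated" mean as a (not necessarily unital) ring. A monoid $S$ is left cancellative if $gh=gt$ implies $h=t$ for all $g,h,t\in S$. An $S$-grading on $R$ is a decomposition $\Gamma: R=\bigoplus_{g\in S}R_g$ into additive subgroups with $R_gR_h\subseteq R_{gh}$ for all $g,h\in S$; its support is $\mathrm{Supp}(\Gamma)=\{g\in S: R_g\neq 0\}$. A ring is nil if each of its elements is nilpotent. A ring $T$ is nilpotent if for some integer $n>0$ one has $a_1\cdots a_n=0$ for all $a_1,\dots,a_n\in T$; the nilpotency index $\mathrm{nd}(T)$ is the smallest such positive integer $n$. A left action of a semigroup $\mathfrak{S}$ on a ring $T$ is a map $\mathfrak{S}\times T\to T$, $(\lambda,x)\mapsto\lambda\cdot x$, with $(\lambda\gamma)\cdot x=\lambda\cdot(\gamma\cdot x)$ and $\lambda\cdot(xy)=(\lambda\cdot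 x)y$ for all $\lambda,\gamma\in\mathfrak{S}$, $x,y\in T$. A ring $T$ is $\mathsf{f}$-commutative if there exist a semigroup $\mathfrak{S}$ acting on the left of $T$ in this sense and a map $\mathsf{f}:T\times T\to\mathfrak{S}$ such that $ab=\mathsf{f}(a,b)\cdot(ba)$ for all $a,b\in T$. *)

theory Defs
  imports Complex_Main
begin

text \<open>
  Rings are not assumed to be unital, so a ring is a type of class \<open>ring\<close> (not \<open>ring_1\<close>).
  Properties of rings are stated for subsets \<open>T\<close> of such a type, so that they apply both to the
  whole ring (\<open>UNIV\<close>) and to its subrings.
\<close>

text \<open>Without a unit only products of nonempty lists make sense; the value at \<open>[]\<close> is
  left unspecified.\<close>

fun nonempty_prod :: "'a::semigroup_mult list \<Rightarrow> 'a" where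
  "nonempty_prod [] = undefined"
| "nonempty_prod [x] = x"
| "nonempty_prod (x # y # xs) = x * nonempty_prod (y # xs)"

text \<open>Meaningful for positive exponents only.\<close>

definition pos_power :: "'a::semigroup_mult \<Rightarrow> nat \<Rightarrow> 'a" where
  "pos_power x m = nonempty_prod (replicate m x)"

definition nil_ring :: "'a::ring set \<Rightarrow> bool" where
  "nil_ring T \<longleftrightarrow> (\<forall>x\<in>T. \<exists>m>0. pos_power x m = 0)"

definition products_vanish :: "'a::ring set \<Rightarrow> nat \<Rightarrow> bool" where
  "products_vanish T n \<longleftrightarrow>
     (\<forall>xs. length xs = n \<and> set xs \<subseteq> T \<longrightarrow> nonempty_prod xs = 0)"

definition nilpotent_ring :: "'a::ring set \<Rightarrow> bool" where
  "nilpotent_ring T \<longleftrightarrow> (\<exists>n>0. products_vanish T n)"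

definition nilpotency_index :: "'a::ring set \<Rightarrow> nat" where
  "nilpotency_index T = (LEAST n. n > 0 \<and> products_vanish T n)"

definition additive_subgroup :: "'a::ring set \<Rightarrow> bool" where
  "additive_subgroup H \<longleftrightarrow> 0 \<in> H \<and> (\<forall>x\<in>H. \<forall>y\<in>H. x - y \<in> H)"

definition nonunital_subring :: "'a::ring set \<Rightarrow> bool" where
  "nonunital_subring B \<longleftrightarrow> additive_subgroup B \<and> (\<forall>x\<in>B. \<forall>y\<in>B. x * y \<in> B)"

definition generates_ring :: "'a::ring set \<Rightarrow> 'a set \<Rightarrow> bool" where
  "generates_ring A T \<longleftrightarrow> nonunital_subring hull A = T"

definition finitely_generated_ring :: "'a::ring set \<Rightarrow> bool" where
  "finitely_generated_ring T \<longleftrightarrow> (\<exists>A. finite A \<and> generates_ring A T)"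

definition ring_grading :: "('g::monoid_mult \<Rightarrow> 'a::ring set) \<Rightarrow> bool" where
  "ring_grading R \<longleftrightarrow>
     (\<forall>g. additive_subgroup (R g)) \<and>
     (\<forall>x. \<exists>!c. (\<forall>g. c g \<in> R g) \<and> finite {g. c g \<noteq> 0} \<and> x = (\<Sum>g | c g \<noteq> 0. c g)) \<and>
     (\<forall>g h. \<forall>x\<in>R g. \<forall>y\<in>R h. x * y \<in> R (g * h))"

definition grading_support :: "('g::monoid_mult \<Rightarrow> 'a::ring set) \<Rightarrow> 'g set" where
  "grading_support R = {g. R g \<noteq> {0}}"

definition left_semigroup_action :: "('s::semigroup_mult \<Rightarrow> 'a::ring \<Rightarrow> 'a) \<Rightarrow> 'a set \<Rightarrow> bool" where
  "left_semigroup_action act T \<longleftrightarrow>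
     (\<forall>l. \<forall>x\<in>T. act l x \<in> T) \<and>
     (\<forall>l m. \<forall>x\<in>T. act (l * m) x = act l (act m x)) \<and>
     (\<forall>l. \<forall>x\<in>T. \<forall>y\<in>T. act l (x * y) = act l x * y)"

text \<open>
  HOL cannot quantify existentially over types, so the acting semigroup is passed as the type
  argument \<open>'s\<close>. In a hypothesis with \<open>'s\<close> a free type variable, this amounts to
  the existence of some acting semigroup.
\<close>

definition f_commutative :: "'s::semigroup_mult itself \<Rightarrow> 'a::ring set \<Rightarrow> bool" where
  "f_commutative (_ :: 's itself) T \<longleftrightarrow>
     (\<exists>(act :: 's \<Rightarrow> 'a \<Rightarrow> 'a) (f :: 'a \<Rightarrow> 'a \<Rightarrow> 's).
        left_semigroup_action act T \<and>
        (\<forall>a\<in>T. \<forall>b\<in>T. a * b = act (f a b) (b * a)))"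

end

theory Submission imports Defs begin

text \<open>
  A product of homogeneous elements can be nonzero only if the degrees of all its nonempty
  prefixes lie in the support. By pigeonhole a long product has many prefixes of the same degree,
  and left cancellation puts the blocks between them in the neutral component, so nilpotency of
  \<open>R 1\<close> passes to the whole ring. In the neutral component, \<open>f\<close>-commutativity
  moves any letter of a word to the front at the cost of an action, which fixes \<open>0\<close>;
  a word with \<open>s\<close> occurrences of a generator \<open>a\<close> therefore vanishes if
  \<open>a\<close> raised to the power \<open>s\<close> does.
\<close>

section \<open>Products of nonempty lists\<close>

lemma nonempty_prod_Cons:
  "xs \<noteq> [] \<Longrightarrow> nonempty_prod (x # xs) = x * nonempty_prod xs"
  by (cases xs) auto

lemma nonempty_prod_append:
  "xs \<noteq> [] \<Longrightarrow> ys \<noteq> [] \<Longrightarrow> nonempty_prod (xs @ ys) = nonempty_prod xs * nonempty_prod ys"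
  by (induction xs rule: nonempty_prod.induct) (auto simp: nonempty_prod_Cons mult.assoc)

text \<open>Lets a product be shown to vanish by exhibiting one zero block in it. The case splits
  are there because an empty flank has no product.\<close>

lemma nonempty_prod_infix_eq_0:
  fixes ys :: "'a::ring list"
  assumes "ys \<noteq> []" "nonempty_prod ys = 0"
  shows "nonempty_prod (us @ ys @ vs) = 0"
proof -
  have "nonempty_prod (ys @ vs) = 0"
    using assms by (cases "vs = []") (auto simp: nonempty_prod_append)
  then show ?thesis
    using assms by (cases "us = []") (auto simp: nonempty_prod_append)
qed

lemma nonempty_prod_concat:
  assumes "bs \<noteq> []" "\<And>b. b \<in> set bs \<Longrightarrow> b \<noteq> []"
  shows "nonempty_prod (concat bs) = nonempty_prod (map nonempty_prod bs)"
  using assms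
proof (induction bs)
  case (Cons b bs)
  show ?case
  proof (cases "bs = []")
    case False
    then have "concat bs \<noteq> []"
      using Cons.prems(2) by (cases bs) auto
    then show ?thesis
      using Cons False by (simp add: nonempty_prod_append nonempty_prod_Cons)
  qed simp
qed simp

lemma nonempty_prod_in_closed:
  assumes "\<And>x y. x \<in> T \<Longrightarrow> y \<in> T \<Longrightarrow> x * y \<in> T" "xs \<noteq> []" "set xs \<subseteq> T"
  shows "nonempty_prod xs \<in> T"
  using assms(2,3) by (induction xs rule: nonempty_prod.induct) (auto intro: assms(1))

text \<open>Additivity in one slot is phrased with differences because
  \<open>additive_subgroup\<close> is. Together with \<open>nonempty_prod_zero\<close> it shows that
  the entries of a slot that kill the product form an additive subgroup.\<close>

lemma nonempty_prod_diff:
  fixes x y :: "'a::ring"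
  shows "nonempty_prod (us @ (x - y) # vs) = nonempty_prod (us @ x # vs) - nonempty_prod (us @ y # vs)"
proof -
  have "nonempty_prod ((x - y) # vs) = nonempty_prod (x # vs) - nonempty_prod (y # vs)"
    by (cases "vs = []") (auto simp: nonempty_prod_Cons algebra_simps)
  then show ?thesis
    by (cases "us = []") (auto simp: nonempty_prod_append right_diff_distrib)
qed

lemma nonempty_prod_zero:
  fixes us vs :: "'a::ring list"
  shows "nonempty_prod (us @ 0 # vs) = 0"
  using nonempty_prod_infix_eq_0[of "[0]" us vs] by simp

lemma pos_power_mono_eq_0:
  fixes x :: "'a::ring"
  assumes "pos_power x m = 0" "0 < m" "m \<le> k"
  shows "pos_power x k = 0"
proof -
  have "replicate k x = [] @ replicate m x @ replicate (k - m) x"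
    using assms by (simp add: replicate_add[symmetric])
  then show ?thesis
    using assms nonempty_prod_infix_eq_0[of "replicate m x" "[]" "replicate (k - m) x"]
    by (simp add: pos_power_def)
qed

section \<open>Additive spans\<close>

lemma additive_subgroup_hull: "additive_subgroup (additive_subgroup hull A)"
  by (rule hull_in) (auto simp: additive_subgroup_def)

lemma nonunital_subring_hull: "nonunital_subring (nonunital_subring hull A)"
  by (rule hull_in) (auto simp: nonunital_subring_def additive_subgroup_def)

lemma additive_subgroup_add:
  "additive_subgroup H \<Longrightarrow> x \<in> H \<Longrightarrow> y \<in> H \<Longrightarrow> x + y \<in> H"
  unfolding additive_subgroup_def by (metis diff_0 diff_minus_eq_add)

lemma additive_subgroup_sum:
  assumes "additive_subgroup H" "\<And>i. i \<in> I \<Longrightarrow> c i \<in> H"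
  shows "sum c I \<in> H"
  using assms(2)
proof (induction I rule: infinite_finite_induct)
  case (insert i I)
  then show ?case
    using assms(1) by (auto intro: additive_subgroup_add)
qed (use assms(1) in \<open>auto simp: additive_subgroup_def\<close>)

text \<open>Products are additive in each slot, so letters from \<open>A\<close> can be replaced by
  elements of the span one slot at a time.\<close>

lemma products_vanish_additive_hull:
  assumes "products_vanish A n"
  shows "products_vanish (additive_subgroup hull A) n"
proof -
  \<comment> \<open>Hybrid words: the entries of \<open>us\<close> lie in \<open>A\<close>, those of
    \<open>xs\<close> in the span. Each induction step moves the boundary by one slot.\<close>
  have "nonempty_prod (us @ xs) = 0"
    if "set us \<subseteq> A" "set xs \<subseteq> additive_subgroup hull A" "length us + length xs = n" for us xs
    using that
  proof (induction xs arbitrary: us)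
    case Nil
    then show ?case
      using assms by (simp add: products_vanish_def)
  next
    case (Cons x xs)
    let ?H = "{y. nonempty_prod (us @ y # xs) = 0}"
    have "additive_subgroup ?H"
      by (auto simp: additive_subgroup_def nonempty_prod_diff nonempty_prod_zero)
    moreover have "A \<subseteq> ?H"
    proof
      fix y assume "y \<in> A"
      then show "y \<in> ?H"
        using Cons.IH[of "us @ [y]"] Cons.prems by auto
    qed
    ultimately have "additive_subgroup hull A \<subseteq> ?H"
      by (intro hull_minimal)
    then show ?case
      using Cons.prems(2) by auto
  qed
  from this[of "[]"] show ?thesis
    by (simp add: products_vanish_def)
qed

section \<open>Reduction from a generated ring to words in its generators\<close>

definition words :: "'a::ring set \<Rightarrow> 'a set" where
  "words A = nonempty_prod ` {w. w \<noteq> [] \<and> set w \<subseteq> A}"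

lemma words_mult: "x \<in> words A \<Longrightarrow> y \<in> words A \<Longrightarrow> x * y \<in> words A"
proof -
  assume "x \<in> words A" "y \<in> words A"
  then obtain v w where "x = nonempty_prod v" "y = nonempty_prod w" "v \<noteq> []" "w \<noteq> []"
    "set v \<subseteq> A" "set w \<subseteq> A"
    by (auto simp: words_def)
  then show ?thesis
    unfolding words_def by (intro image_eqI[of _ _ "v @ w"]) (auto simp: nonempty_prod_append)
qed

text \<open>Closure under products follows by distributivity in two stages: first the left factor
  stays in \<open>W\<close> while the right one runs over the span, then the right factor is fixed
  and the left one runs over the span.\<close>

lemma nonunital_subring_additive_hull:
  assumes "\<And>x y. x \<in> W \<Longrightarrow> y \<in> W \<Longrightarrow> x * y \<in> W"
  shows "nonunital_subring (additive_subgroup hull W)"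
proof -
  let ?H = "additive_subgroup hull W"
  have H: "0 \<in> ?H" "\<And>x y. x \<in> ?H \<Longrightarrow> y \<in> ?H \<Longrightarrow> x - y \<in> ?H"
    using additive_subgroup_hull[of W] by (auto simp: additive_subgroup_def)
  have left: "w * y \<in> ?H" if "w \<in> W" "y \<in> ?H" for w y
  proof -
    have "additive_subgroup {y. w * y \<in> ?H}"
      using H by (auto simp: additive_subgroup_def right_diff_distrib)
    moreover have "W \<subseteq> {y. w * y \<in> ?H}"
      using assms[OF \<open>w \<in> W\<close>] by (auto intro: hull_inc)
    ultimately show ?thesis
      using hull_minimal[of W "{y. w * y \<in> ?H}" additive_subgroup] that by auto
  qed
  have "x * y \<in> ?H" if "x \<in> ?H" "y \<in> ?H" for x y
  proof -
    have "additive_subgroup {x. x * y \<in> ?H}"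
      using H by (auto simp: additive_subgroup_def left_diff_distrib)
    moreover have "W \<subseteq> {x. x * y \<in> ?H}"
      using left \<open>y \<in> ?H\<close> by auto
    ultimately show ?thesis
      using hull_minimal[of W "{x. x * y \<in> ?H}" additive_subgroup] that by auto
  qed
  then show ?thesis
    using additive_subgroup_hull by (auto simp: nonunital_subring_def)
qed

lemma subring_hull_subset_words:
  "nonunital_subring hull A \<subseteq> additive_subgroup hull (words A)"
proof (rule hull_minimal)
  have "a \<in> words A" if "a \<in> A" for a
    unfolding words_def using that by (intro image_eqI[of _ _ "[a]"]) auto
  then show "A \<subseteq> additive_subgroup hull (words A)"
    by (auto intro: hull_inc)
qed (rule nonunital_subring_additive_hull[OF words_mult])

text \<open>The hypothesis covers all lengths from \<open>N\<close> on, since a product of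
  \<open>N\<close> elements of \<open>words A\<close> concatenates to a word whose length is only
  bounded below by \<open>N\<close>.\<close>

lemma products_vanish_if_words_vanish:
  assumes "generates_ring A T" "N > 0"
    and words: "\<And>w. set w \<subseteq> A \<Longrightarrow> N \<le> length w \<Longrightarrow> nonempty_prod w = 0"
  shows "products_vanish T N"
proof -
  have "products_vanish (words A) N"
    unfolding products_vanish_def
  proof (intro allI impI)
    fix xs assume xs: "length xs = N \<and> set xs \<subseteq> words A"
    then have "\<forall>x\<in>set xs. \<exists>w. x = nonempty_prod w \<and> w \<noteq> [] \<and> set w \<subseteq> A"
      by (auto simp: words_def)
    then obtain v where v: "\<And>x. x \<in> set xs \<Longrightarrow> x = nonempty_prod (v x) \<and> v x \<noteq> [] \<and> set (v x) \<subseteq> A"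
      by metis
    \<comment> \<open>Each factor contributes at least one letter.\<close>
    have len: "length ys \<le> length (concat (map v ys))" if "\<forall>y\<in>set ys. v y \<noteq> []" for ys
      using that
    proof (induction ys)
      case (Cons y ys)
      then have "1 \<le> length (v y)"
        by (simp add: Suc_le_eq)
      then show ?case
        using Cons by simp
    qed simp
    have "xs = map nonempty_prod (map v xs)"
      using v by (auto intro!: map_idI[symmetric])
    then have "nonempty_prod xs = nonempty_prod (concat (map v xs))"
      using nonempty_prod_concat[of "map v xs"] v xs \<open>N > 0\<close> by fastforce
    also have "\<dots> = 0"
      using v xs len[of xs] by (intro words) fastforce+
    finally show "nonempty_prod xs = 0" .
  qed
  then have "products_vanish (additive_subgroup hull (words A)) N"
    by (rule products_vanish_additive_hull)
  moreover have "T \<subseteq> additive_subgroup hull (words A)"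
    using assms(1) subring_hull_subset_words[of A] by (simp add: generates_ring_def)
  ultimately show ?thesis
    by (auto simp: products_vanish_def)
qed

section \<open>The neutral component\<close>

text \<open>If \<open>p\<close> and \<open>q\<close> are the products of \<open>u\<close> and
  \<open>v\<close>, then \<open>p * a * q = act (f p a) (a * p * q)\<close>, and the action sends
  \<open>0\<close> to \<open>0\<close>.\<close>

lemma f_commutative_prod_eq_0_if_front:
  fixes T :: "'a::ring set"
  assumes fc: "f_commutative TYPE('s::semigroup_mult) T"
    and T: "nonunital_subring T"
    and mem: "set u \<subseteq> T" "set v \<subseteq> T" "a \<in> T"
    and front: "nonempty_prod (a # u @ v) = 0"
  shows "nonempty_prod (u @ a # v) = 0"
proof (cases "u = []")
  case False
  obtain act :: "'s \<Rightarrow> 'a \<Rightarrow> 'a" and f where act: "left_semigroup_action act T"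
    and f: "\<And>a b. a \<in> T \<Longrightarrow> b \<in> T \<Longrightarrow> a * b = act (f a b) (b * a)"
    using fc unfolding f_commutative_def by blast
  have T_mult: "\<And>x y. x \<in> T \<Longrightarrow> y \<in> T \<Longrightarrow> x * y \<in> T" and "0 \<in> T"
    using T by (auto simp: nonunital_subring_def additive_subgroup_def)
  have act_mult: "act l (x * y) = act l x * y" if "x \<in> T" "y \<in> T" for l x y
    using act that by (auto simp: left_semigroup_action_def)
  \<comment> \<open>The action need not be additive; instead
    \<open>act l 0 = act l (0 * 0) = act l 0 * 0 = 0\<close>.\<close>
  have act_0: "act l 0 = 0" for l
    using act_mult[OF \<open>0 \<in> T\<close> \<open>0 \<in> T\<close>, of l] by simp
  define p where "p = nonempty_prod u"
  have p: "p \<in> T"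
    unfolding p_def using False mem T_mult by (intro nonempty_prod_in_closed) auto
  have pa: "p * a = act (f p a) (a * p)"
    using f p mem by blast
  show ?thesis
  proof (cases "v = []")
    case True
    then show ?thesis
      using False front pa act_0
      by (simp add: nonempty_prod_append nonempty_prod_Cons p_def[symmetric])
  next
    case v: False
    define q where "q = nonempty_prod v"
    have q: "q \<in> T"
      unfolding q_def using v mem T_mult by (intro nonempty_prod_in_closed) auto
    have "a * p * q = 0"
      using front False v
      by (simp add: nonempty_prod_append nonempty_prod_Cons p_def q_def mult.assoc)
    then have "p * a * q = 0"
      using act_mult[of "a * p" q "f p a"] pa p q mem T_mult act_0 by simp
    then show ?thesis
      using False v by (simp add: nonempty_prod_append nonempty_prod_Cons p_def q_def mult.assoc)
  qed
qed (use front in simp)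

text \<open>Collect \<open>s\<close> copies of \<open>a\<close> at the front, one at a time; the
  resulting prefix has product \<open>pos_power a s = 0\<close>, and vanishing is carried back
  through each move.\<close>

lemma f_commutative_word_eq_0:
  fixes T :: "'a::ring set"
  assumes fc: "f_commutative TYPE('s::semigroup_mult) T"
    and T: "nonunital_subring T"
    and "a \<in> T" "pos_power a s = 0" "s > 0" "set w \<subseteq> T" "s \<le> count_list w a"
  shows "nonempty_prod w = 0"
proof -
  have "nonempty_prod (replicate j a @ w) = 0"
    if "j \<le> s" "set w \<subseteq> T" "s \<le> j + count_list w a" for j w
    using that
  \<comment> \<open>Downward induction from \<open>j = s\<close>: with \<open>j\<close> copies
    already in front, at least \<open>s - j\<close> remain in \<open>w\<close>.\<close>
  proof (induction j arbitrary: w rule: inc_induct)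
    case base
    then show ?case
      using nonempty_prod_infix_eq_0[of "replicate s a" "[]" w] assms(4,5)
      by (simp add: pos_power_def)
  next
    case (step j)
    then have "a \<in> set w"
      using count_list_0_iff[of w a] by fastforce
    then obtain u v where w: "w = u @ a # v"
      by (meson split_list)
    have "nonempty_prod (replicate (Suc j) a @ u @ v) = 0"
      using step w by (intro step.IH) auto
    then have "nonempty_prod ((replicate j a @ u) @ a # v) = 0"
      using step.prems w \<open>a \<in> T\<close> by (intro f_commutative_prod_eq_0_if_front[OF fc T]) auto
    then show ?case
      using w by simp
  qed
  from this[of 0] show ?thesis
    using assms by simp
qed

text \<open>If every letter occurred at most \<open>s - 1\<close> times, the word would have length
  at most \<open>(s - 1) * n\<close>.\<close>

lemma exists_frequent_letter:
  assumes "set w \<subseteq> A" "finite A" "card A \<le> n" "(s - 1) * n + 1 \<le> length w"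
  shows "\<exists>a\<in>A. s \<le> count_list w a"
proof (rule ccontr)
  assume "\<not> ?thesis"
  then have "\<And>a. a \<in> A \<Longrightarrow> count_list w a \<le> s - 1"
    by force
  then have "(\<Sum>a\<in>A. count_list w a) \<le> card A * (s - 1)"
    using sum_bounded_above[of A "count_list w" "s - 1"] by simp
  also have "\<dots> \<le> (s - 1) * n"
    using assms(3) by simp
  finally show False
    using sum_count_set[OF assms(1,2)] assms(4) by simp
qed

text \<open>A long word repeats some generator \<open>s\<close> times and therefore vanishes. The
  bound \<open>card A \<le> n\<close> allows for repetitions in a list of \<open>n\<close>
  generators.\<close>

lemma f_commutative_products_vanish:
  fixes T :: "'a::ring set"
  assumes fc: "f_commutative TYPE('s::semigroup_mult) T"
    and gen: "generates_ring A T" and A: "finite A" "card A \<le> n"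
    and s: "s > 0" "\<And>a. a \<in> A \<Longrightarrow> pos_power a s = 0"
  shows "products_vanish T ((s - 1) * n + 1)"
proof (rule products_vanish_if_words_vanish[OF gen])
  have T: "nonunital_subring T" "A \<subseteq> T"
    using gen nonunital_subring_hull[of A] hull_subset[of A nonunital_subring]
    by (auto simp: generates_ring_def)
  fix w assume w: "set w \<subseteq> A" "(s - 1) * n + 1 \<le> length w"
  then obtain a where "a \<in> A" "s \<le> count_list w a"
    using exists_frequent_letter A by metis
  then show "nonempty_prod w = 0"
    using f_commutative_word_eq_0[OF fc T(1)] T(2) s w by blast
qed simp

section \<open>Gradings\<close>

lemma generalized_pigeonhole:
  assumes "finite I" "finite S" "f ` I \<subseteq> S" "card S * k < card I"
  shows "\<exists>y\<in>S. k < card {x\<in>I. f x = y}"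
proof (rule ccontr)
  assume "\<not> ?thesis"
  then have "(\<Sum>y\<in>S. card {x\<in>I. f x = y}) \<le> card S * k"
    using sum_bounded_above[of S "\<lambda>y. card {x\<in>I. f x = y}" k] by force
  moreover have "(\<Sum>y\<in>S. card {x\<in>I. f x = y}) = card I"
    using sum.group[OF assms(1-3), of "\<lambda>_. 1::nat"] by simp
  ultimately show False
    using assms(4) by simp
qed

text \<open>Two cuts with the same prefix degree \<open>g\<close> enclose a block of degree
  \<open>h\<close> with \<open>g * h = g * 1\<close>, so \<open>h = 1\<close> by left cancellation.
  The clause on \<open>Max I\<close> records where the last block ends, so that the induction can
  attach the next one.\<close>

lemma neutral_blocks:
  fixes \<delta> :: "'b \<Rightarrow> 'g::monoid_mult"
  assumes cancel: "\<forall>g h t :: 'g. g * h = g * t \<longrightarrow> h = t"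
    and "card I = Suc N" "I \<subseteq> {..length xs}"
    and "\<And>i. i \<in> I \<Longrightarrow> prod_list (map \<delta> (take i xs)) = g"
  shows "\<exists>us bs vs. xs = us @ concat bs @ vs \<and> length bs = N \<and>
    length (us @ concat bs) = Max I \<and> (\<forall>b\<in>set bs. b \<noteq> [] \<and> prod_list (map \<delta> b) = 1)"
  using assms(2-4)
proof (induction N arbitrary: I)
  case 0
  then obtain i where "I = {i}"
    by (metis One_nat_def card_1_singletonE)
  then show ?case
    using 0 by (intro exI[of _ "take i xs"] exI[of _ "[]"] exI[of _ "drop i xs"]) auto
next
  case (Suc N)
  have I: "finite I" "I \<noteq> {}"
    using Suc.prems(1) by (auto intro: card_ge_0_finite)
  \<comment> \<open>The new block \<open>b\<close> is the segment between the two largest cuts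
    \<open>m\<close> and \<open>M\<close>.\<close>
  define M where "M = Max I"
  have M: "M \<in> I"
    using I by (simp add: M_def)
  let ?I = "I - {M}"
  have cardI: "card ?I = Suc N"
    using Suc.prems(1) I M by simp
  define m where "m = Max ?I"
  have m: "m \<in> ?I"
    unfolding m_def using cardI I by (intro Max_in) force+
  have "m < M"
    using m I unfolding M_def by (metis DiffE Max_ge insertI1 le_neq_implies_less)
  obtain us bs vs where xs: "xs = us @ concat bs @ vs" and bs: "length bs = N"
    "length (us @ concat bs) = m" "\<forall>b\<in>set bs. b \<noteq> [] \<and> prod_list (map \<delta> b) = 1"
    using Suc.IH[OF cardI] Suc.prems(2,3) unfolding m_def by blast
  define b where "b = take (M - m) vs"
  have "M \<le> length xs"
    using M Suc.prems(2) by auto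
  then have len: "length b = M - m"
    using xs bs(2) by (simp add: b_def)
  have "take M xs = take m xs @ b" and take_m: "take m xs = us @ concat bs"
    using xs bs(2) \<open>m < M\<close> by (auto simp: b_def)
  then have "g = g * prod_list (map \<delta> b)"
    using Suc.prems(3)[OF M] Suc.prems(3)[of m] m by (metis DiffD1 map_append prod_list.append)
  then have "prod_list (map \<delta> b) = 1"
    by (metis cancel mult.right_neutral)
  moreover have "b \<noteq> []"
    using len \<open>m < M\<close> by auto
  moreover have "xs = us @ concat (bs @ [b]) @ drop (M - m) vs"
    using xs by (simp add: b_def)
  moreover have "length (us @ concat (bs @ [b])) = M"
    using bs(2) len \<open>m < M\<close> by simp
  moreover have "length (bs @ [b]) = Suc N"
    using bs(1) by simp
  ultimately have "xs = us @ concat (bs @ [b]) @ drop (M - m) vs \<and> length (bs @ [b]) = Suc N \<and>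
      length (us @ concat (bs @ [b])) = Max I \<and>
      (\<forall>b\<in>set (bs @ [b]). b \<noteq> [] \<and> prod_list (map \<delta> b) = 1)"
    using bs(3) unfolding M_def by auto
  then show ?case
    by blast
qed

context
  fixes R :: "'g::monoid_mult \<Rightarrow> 'a::ring set"
  assumes cancel: "\<forall>g h t :: 'g. g * h = g * t \<longrightarrow> h = t"
    and grading: "ring_grading R"
begin

lemma grading_mult: "x \<in> R g \<Longrightarrow> y \<in> R h \<Longrightarrow> x * y \<in> R (g * h)"
  using grading by (auto simp: ring_grading_def)

lemma nonempty_prod_homogeneous:
  assumes "xs \<noteq> []" "\<And>x. x \<in> set xs \<Longrightarrow> x \<in> R (\<delta> x)"
  shows "nonempty_prod xs \<in> R (prod_list (map \<delta> xs))"
  using assms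
proof (induction xs rule: nonempty_prod.induct)
  case (3 x y xs)
  have "nonempty_prod (y # xs) \<in> R (prod_list (map \<delta> (y # xs)))"
    using 3 by auto
  then show ?case
    using grading_mult[of x "\<delta> x"] 3 by simp
qed auto

text \<open>Every element is a finite sum of homogeneous ones, so the additive span of the
  components is the whole ring.\<close>

lemma products_vanish_if_homogeneous:
  assumes "products_vanish (\<Union>g. R g) n"
  shows "products_vanish (UNIV :: 'a set) n"
proof -
  let ?H = "additive_subgroup hull (\<Union>g. R g)"
  have "x \<in> ?H" for x
  proof -
    obtain c where c: "\<And>g. c g \<in> R g" "x = (\<Sum>g | c g \<noteq> 0. c g)"
      using grading unfolding ring_grading_def by metis
    have "c g \<in> ?H" for g
      using c(1) by (intro hull_inc) auto
    then show ?thesis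
      unfolding c(2) by (intro additive_subgroup_sum additive_subgroup_hull)
  qed
  then have "?H = UNIV"
    by blast
  then show ?thesis
    using products_vanish_additive_hull[OF assms] by simp
qed

text \<open>
  The index \<open>0\<close> of the empty prefix, whose degree is \<open>1\<close>, may be counted
  only if \<open>1\<close> belongs to the support; hence the choice of \<open>I\<close>.
\<close>

lemma homogeneous_prod_eq_0:
  assumes fin: "finite (grading_support R)"
    and van: "products_vanish (R 1) N" "N > 0"
    and I: "I \<subseteq> {..length xs}" "0 \<in> I \<Longrightarrow> R 1 \<noteq> {0}" "card (grading_support R) * N < card I"
    and hom: "set xs \<subseteq> (\<Union>g. R g)" "xs \<noteq> []"
  shows "nonempty_prod xs = 0"
proof (rule ccontr)
  assume nz: "nonempty_prod xs \<noteq> 0"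
  \<comment> \<open>A degree is chosen for each homogeneous element; \<open>0\<close> lies in every
    component, so its degree is arbitrary.\<close>
  define \<delta> where "\<delta> x = (SOME g. x \<in> R g)" for x
  have \<delta>: "x \<in> R (\<delta> x)" if "x \<in> set xs" for x
  proof -
    have "\<exists>g. x \<in> R g"
      using hom(1) that by auto
    then show ?thesis
      unfolding \<delta>_def by (rule someI_ex)
  qed
  let ?p = "\<lambda>i. prod_list (map \<delta> (take i xs))"
  \<comment> \<open>A nonempty prefix has nonzero product, since otherwise the whole product would
    vanish; this product witnesses that its degree is in the support.\<close>
  have "?p i \<in> grading_support R" if "i \<in> I" for i
  proof (cases "i = 0")
    case True
    then show ?thesis
      using I(2) that by (simp add: grading_support_def)
  next
    case False
    then have ne: "take i xs \<noteq> []"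
      using hom(2) by simp
    have "nonempty_prod (take i xs) \<noteq> 0"
      using nonempty_prod_infix_eq_0[OF ne, of "[]" "drop i xs"] nz by auto
    moreover have "nonempty_prod (take i xs) \<in> R (?p i)"
      using ne \<delta> by (intro nonempty_prod_homogeneous) (auto dest: in_set_takeD)
    ultimately show ?thesis
      by (auto simp: grading_support_def)
  qed
  moreover have "finite I"
    using I(1) finite_subset by blast
  ultimately obtain g where "N < card {i\<in>I. ?p i = g}"
    using generalized_pigeonhole[of I "grading_support R" ?p N] fin I(3) by blast
  \<comment> \<open>\<open>Suc N\<close> cuts of equal prefix degree delimit exactly
    \<open>N\<close> adjacent neutral blocks.\<close>
  then obtain J where J: "J \<subseteq> {i\<in>I. ?p i = g}" "card J = Suc N"
    by (meson Suc_leI obtain_subset_with_card_n)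
  obtain us bs vs where xs: "xs = us @ concat bs @ vs" and bs: "length bs = N"
    "\<And>b. b \<in> set bs \<Longrightarrow> b \<noteq> [] \<and> prod_list (map \<delta> b) = 1"
  proof -
    have "J \<subseteq> {..length xs}" "\<And>i. i \<in> J \<Longrightarrow> ?p i = g"
      using J(1) I(1) by auto
    from neutral_blocks[OF cancel J(2) this] show ?thesis
      using that by metis
  qed
  have "nonempty_prod b \<in> R 1" if "b \<in> set bs" for b
  proof -
    have "nonempty_prod b \<in> R (prod_list (map \<delta> b))"
      using \<delta> xs bs(2)[OF that] that by (intro nonempty_prod_homogeneous) auto
    then show ?thesis
      using bs(2)[OF that] by simp
  qed
  \<comment> \<open>The block products are \<open>N\<close> factors from \<open>R 1\<close>, so the
    infix \<open>concat bs\<close> is a zero block of \<open>xs\<close>.\<close>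
  then have "nonempty_prod (map nonempty_prod bs) = 0"
    using van(1) bs(1) unfolding products_vanish_def by (metis image_subsetI length_map set_map)
  moreover have "bs \<noteq> []"
    using bs(1) van(2) by auto
  moreover have "concat bs \<noteq> []"
    using bs(2) \<open>bs \<noteq> []\<close> by (cases bs) auto
  ultimately show False
    using nonempty_prod_concat[of bs] bs(2) nonempty_prod_infix_eq_0[of "concat bs" us vs] xs nz
    by auto
qed

text \<open>Here \<open>1\<close> lies in the support, so the empty prefix counts too: with
  \<open>d\<close> degrees, a word of length \<open>d * N\<close> has \<open>d * N + 1\<close>
  prefixes, enough for the pigeonhole. Positivity of \<open>d\<close> makes this length
  positive.\<close>

lemma products_vanish_graded:
  assumes fin: "finite (grading_support R)"
    and "products_vanish (R 1) N" "N > 0" "R 1 \<noteq> {0}"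
  shows "products_vanish (UNIV :: 'a set) (card (grading_support R) * N)"
    and "card (grading_support R) > 0"
proof -
  show pos: "card (grading_support R) > 0"
    using fin assms(4) by (auto simp: card_gt_0_iff grading_support_def)
  show "products_vanish (UNIV :: 'a set) (card (grading_support R) * N)"
  proof (rule products_vanish_if_homogeneous, unfold products_vanish_def, intro allI impI)
    fix xs assume xs: "length xs = card (grading_support R) * N \<and> set xs \<subseteq> (\<Union>g. R g)"
    then show "nonempty_prod xs = 0"
      using assms pos by (intro homogeneous_prod_eq_0[where I = "{..length xs}" and N = N]) auto
  qed
qed

text \<open>A single neutral block is already zero, so \<open>N = 1\<close>. The empty prefix is now
  excluded, which costs one extra letter.\<close>

lemma products_vanish_graded_trivial:
  assumes fin: "finite (grading_support R)" and "R 1 = {0}"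
  shows "products_vanish (UNIV :: 'a set) (card (grading_support R) + 1)"
proof (rule products_vanish_if_homogeneous, unfold products_vanish_def, intro allI impI)
  fix xs assume xs: "length xs = card (grading_support R) + 1 \<and> set xs \<subseteq> (\<Union>g. R g)"
  have "products_vanish (R 1) 1"
    using assms(2) by (auto simp: products_vanish_def length_Suc_conv)
  then show "nonempty_prod xs = 0"
    using xs fin by (intro homogeneous_prod_eq_0[where I = "{1..length xs}" and N = 1]) auto
qed

end

section \<open>Nilpotency index and the final bounds\<close>

lemma nilpotency_index_le:
  "products_vanish T n \<Longrightarrow> n > 0 \<Longrightarrow> nilpotency_index T \<le> n"
  unfolding nilpotency_index_def by (rule Least_le) simp

lemma nilpotency_index_products_vanish:
  assumes "nilpotent_ring T"
  shows "nilpotency_index T > 0" "products_vanish T (nilpotency_index T)"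
  using LeastI_ex[of "\<lambda>n. n > 0 \<and> products_vanish T n"] assms
  by (auto simp: nilpotent_ring_def nilpotency_index_def)

lemma nil_ring_common_exponent:
  assumes "nil_ring T" "finite A" "A \<subseteq> T"
  shows "\<exists>m>0. \<forall>x\<in>A. pos_power x m = 0"
proof -
  obtain k where k: "\<And>x. x \<in> T \<Longrightarrow> k x > 0 \<and> pos_power x (k x) = 0"
    using assms(1) unfolding nil_ring_def by metis
  \<comment> \<open>The sum dominates every single exponent; \<open>Suc\<close> keeps it positive
    when \<open>A\<close> is empty.\<close>
  have "pos_power x (Suc (\<Sum>x\<in>A. k x)) = 0" if "x \<in> A" for x
    using k[of x] that assms(3) member_le_sum[of x A k] assms(2)
    by (auto intro!: pos_power_mono_eq_0[of x "k x" "Suc (\<Sum>x\<in>A. k x)"])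
  then show ?thesis
    by blast
qed

theorem theorem4p8:
  fixes R :: "'g::monoid_mult \<Rightarrow> 'a::ring set"
  assumes left_cancellative: "\<And>g h t :: 'g. g * h = g * t \<Longrightarrow> h = t"
    and grading: "ring_grading R"
    and finite_support: "finite (grading_support R)"
    and nil: "nil_ring (R 1)"
    and f_comm: "f_commutative TYPE('s::semigroup_mult) (R 1)"
    and fin_gen: "finitely_generated_ring (R 1)"
  shows "nilpotent_ring (UNIV :: 'a set) \<and>
    (R 1 \<noteq> {0} \<longrightarrow>
      (\<forall>(n::nat) (a :: nat \<Rightarrow> 'a). generates_ring (a ` {1..n}) (R 1) \<longrightarrow>
        (let s = (LEAST m. m > 0 \<and> (\<forall>i\<in>{1..n}. pos_power (a i) m = 0));
             d = card (grading_support R)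
         in s \<le> nilpotency_index (UNIV :: 'a set) \<and>
            nilpotency_index (UNIV :: 'a set) \<le> d * ((s - 1) * n + 1)))) \<and>
    (R 1 = {0} \<longrightarrow>
      1 \<le> nilpotency_index (UNIV :: 'a set) \<and>
      nilpotency_index (UNIV :: 'a set) \<le> card (grading_support R) + 1)"
proof -
  have cancel: "\<forall>g h t :: 'g. g * h = g * t \<longrightarrow> h = t"
    using left_cancellative by blast
  let ?d = "card (grading_support R)"
  have vanish: "products_vanish (UNIV :: 'a set) (?d * ((s - 1) * n + 1))" "?d > 0"
    if "R 1 \<noteq> {0}" "generates_ring A (R 1)" "finite A" "card A \<le> n" "s > 0"
      "\<And>x. x \<in> A \<Longrightarrow> pos_power x s = 0" for A s n
    using products_vanish_graded[OF cancel grading finite_support]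
      f_commutative_products_vanish[OF f_comm that(2-6)] that(1) by (simp_all del: mult_Suc_right)
  have generators: "A \<subseteq> R 1" if "generates_ring A (R 1)" for A
    using that hull_subset[of A nonunital_subring] by (simp add: generates_ring_def)
  note trivial = products_vanish_graded_trivial[OF cancel grading finite_support]
  have nilpotent: "nilpotent_ring (UNIV :: 'a set)"
  proof (cases "R 1 = {0}")
    case True
    then show ?thesis
      using trivial by (auto simp: nilpotent_ring_def)
  next
    case False
    obtain A where A: "finite A" "generates_ring A (R 1)"
      using fin_gen by (auto simp: finitely_generated_ring_def)
    obtain m where "m > 0" "\<And>x. x \<in> A \<Longrightarrow> pos_power x m = 0"
      using nil_ring_common_exponent[OF nil A(1) generators[OF A(2)]] by blast
    then show ?thesis
      using vanish[OF False A(2,1) order_refl] unfolding nilpotent_ring_def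
      by (metis add_gr_0 less_one mult_pos_pos)
  qed
  note index = nilpotency_index_products_vanish[OF nilpotent]
  have "s \<le> nilpotency_index (UNIV :: 'a set)"
    "nilpotency_index (UNIV :: 'a set) \<le> ?d * ((s - 1) * n + 1)"
    if "R 1 \<noteq> {0}" "generates_ring (a ` {1..n}) (R 1)"
      and s_def: "s = (LEAST m. m > 0 \<and> (\<forall>i\<in>{1..n}. pos_power (a i) m = 0))"
    for n s and a :: "nat \<Rightarrow> 'a"
  proof -
    \<comment> \<open>A power is a product of equal factors. Hence the nilpotency index is an
      admissible exponent, which shows both that the minimum \<open>s\<close> is attained and that
      it is at most this index.\<close>
    have pow: "pos_power x (nilpotency_index (UNIV :: 'a set)) = 0" for x :: 'a
      using index(2) by (simp add: products_vanish_def pos_power_def)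
    show "s \<le> nilpotency_index (UNIV :: 'a set)"
      unfolding s_def using index(1) pow by (intro Least_le) simp
    have "s > 0 \<and> (\<forall>i\<in>{1..n}. pos_power (a i) s = 0)"
      unfolding s_def by (rule LeastI[of _ "nilpotency_index (UNIV :: 'a set)"])
        (use index(1) pow in simp)
    moreover have "card (a ` {1..n}) \<le> n"
      using card_image_le[of "{1..n}" a] by simp
    ultimately have "products_vanish (UNIV :: 'a set) (?d * ((s - 1) * n + 1))" "?d > 0"
      using vanish[OF that(1,2), of n s] by blast+
    then show "nilpotency_index (UNIV :: 'a set) \<le> ?d * ((s - 1) * n + 1)"
      by (intro nilpotency_index_le) auto
  qed
  moreover have "nilpotency_index (UNIV :: 'a set) \<le> ?d + 1" if "R 1 = {0}"
    using trivial[OF that] by (intro nilpotency_index_le) auto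
  ultimately show ?thesis
    using nilpotent index(1) by (auto simp: Let_def Suc_le_eq)
qed

end
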